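(* Let $w_0\ge1$, $d_0\ge1$, $h\ge1$ be integers and let $|\Psi\rangle=\mathcal N^{-1/2}\sum_{\vec s\in\{\pm1\}^n}\Psi(\vec s)|\vec s\rangle$ be a (nonzero, normalized) multilayer perceptron neural quantum state on $n$ spins of width $w_0$ and depth $d_0$ whose nonlinearities are polynomials of degree at most $h$. Then for every subset $A\subset\{1,\ldots,n\}$ the von Neumann entanglement entropy satisfies $$S_A\le w_0\log\left[\frac{(h^{d_0}+1)(h^{d_0}+2)}{2}\right].$$
   Context: $|\vec s\rangle$ is the standard product orthonormal basis of $(\mathbb C^2)^{\otimes n}$. $S_A=-\mathrm{Tr}(\rho_A\log\rho_A)$ with $\rho_A=\mathrm{Tr}_{\bar A}|\Psi\rangle\langle\Psi|$, $\bar A$ the complement of $A$. Multilayer perceptron neural quantum state of width $w_0$ and depth $d_0$: set $\vec h^{(0)}=\vec s\in\{\pm1\}^n$ and, for $\ell=1,\ldots,d_0$, $\vec h^{(\ell)}=\sigma(W^{(\ell)}\vec h^{(\ell-1)}+\vec b^{(\ell)})$, where $W^{(1)}\in\mathbb R^{w_0\times n}$, $W^{(\ell)}\in\mathbb R^{w_0\times w_0}$ for $\ell\ge2$, $\vec b^{(\ell)}\in\mathbb R^{w_0}$, and the scalar nonlinearity $\sigma$ is applied entrywise. The (unnormalized) amplitude is the complex affine projection $\Psi(\vec s)=(\vec w_R^T\vec h^{(d_0)}+b_R)+i(\vec w_I^T\vec h^{(d_0)}+b_I)$ with $\vec w_R,\vec w_I\in\mathbb R^{w_0}$, $b_R,b_I\in\mathbb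 R$. Nonlinearities here are scalar polynomials of degree at most $h$. *)

theory Defs
  imports Jordan_Normal_Form.Schur_Decomposition "HOL-Computational_Algebra.Polynomial"
begin

text \<open>
  Sites are numbered \<open>0, \<dots>, n - 1\<close>. A basis state of the spin space is labelled by its
  configuration, a real vector with entries \<open>\<plusminus>1\<close>, and a state is given by its amplitudes
  in the product basis.
\<close>

definition spin_configs :: "nat \<Rightarrow> real vec set" where
  "spin_configs n = {s \<in> carrier_vec n. \<forall>i<n. s $ i \<in> {-1, 1}}"

text \<open>\<open>W l\<close> and \<open>b l\<close> are only used for \<open>1 \<le> l \<le> d0\<close>.\<close>

primrec mlp_hidden ::
  "(real \<Rightarrow> real) \<Rightarrow> (nat \<Rightarrow> real mat) \<Rightarrow> (nat \<Rightarrow> real vec) \<Rightarrow> real vec \<Rightarrow> nat \<Rightarrow> real vec" where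
  "mlp_hidden \<sigma> W b s 0 = s"
| "mlp_hidden \<sigma> W b s (Suc l) =
     map_vec \<sigma> (W (Suc l) *\<^sub>v mlp_hidden \<sigma> W b s l + b (Suc l))"

definition mlp_amplitude ::
  "(real \<Rightarrow> real) \<Rightarrow> nat \<Rightarrow> (nat \<Rightarrow> real mat) \<Rightarrow> (nat \<Rightarrow> real vec) \<Rightarrow>
   real vec \<Rightarrow> real \<Rightarrow> real vec \<Rightarrow> real \<Rightarrow> real vec \<Rightarrow> complex" where
  "mlp_amplitude \<sigma> d0 W b wR bR wI bI s =
     Complex (wR \<bullet> mlp_hidden \<sigma> W b s d0 + bR) (wI \<bullet> mlp_hidden \<sigma> W b s d0 + bI)"

definition normalize_state :: "nat \<Rightarrow> (real vec \<Rightarrow> complex) \<Rightarrow> real vec \<Rightarrow> complex" where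
  "normalize_state n \<Psi> s =
     \<Psi> s / complex_of_real (sqrt (\<Sum>t\<in>spin_configs n. (cmod (\<Psi> t))\<^sup>2))"

text \<open>
  The configurations of a finite set \<open>A\<close> of sites are enumerated by the numbers below
  \<open>2 ^ card A\<close>: the \<open>j\<close>-th smallest site of \<open>A\<close> carries the spin given by bit \<open>j\<close>.
  \<open>joint_config n A i k\<close> is the configuration of all \<open>n\<close> sites that is the \<open>i\<close>-th one on \<open>A\<close>
  and the \<open>k\<close>-th one on the complement of \<open>A\<close>.
\<close>

definition local_spin :: "nat set \<Rightarrow> nat \<Rightarrow> nat \<Rightarrow> real" where
  "local_spin A i x = (if bit i (card {y \<in> A. y < x}) then -1 else 1)"

definition joint_config :: "nat \<Rightarrow> nat set \<Rightarrow> nat \<Rightarrow> nat \<Rightarrow> real vec" where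
  "joint_config n A i k =
     vec n (\<lambda>x. if x \<in> A then local_spin A i x else local_spin ({..<n} - A) k x)"

lemma bit_eq_iff_below:
  fixes i j :: nat
  assumes "i < 2 ^ m" and "j < 2 ^ m" and "\<And>l. l < m \<Longrightarrow> bit i l = bit j l"
  shows "i = j"
proof (rule bit_eqI)
  fix l show "bit i l = bit j l"
  proof (cases "l < m")
    case False
    then have "(2::nat) ^ m \<le> 2 ^ l" by simp
    then have "i < 2 ^ l" "j < 2 ^ l" using assms by linarith+
    then show ?thesis by (simp add: bit_iff_odd)
  qed (use assms in simp)
qed

lemma local_spin_inj:
  assumes "finite A" and "i < 2 ^ card A" and "j < 2 ^ card A"
    and eq: "\<And>x. x \<in> A \<Longrightarrow> local_spin A i x = local_spin A j x"
  shows "i = j"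
proof (rule bit_eq_iff_below[OF assms(2,3)])
  fix l assume l: "l < card A"
  define x where "x = sorted_list_of_set A ! l"
  have len: "length (sorted_list_of_set A) = card A" by simp
  have x: "x \<in> A" using l assms(1) len unfolding x_def by (metis nth_mem set_sorted_list_of_set)
  have sm: "sorted_list_of_set A ! a < sorted_list_of_set A ! c \<longleftrightarrow> a < c"
    if "a < card A" "c < card A" for a c
    using that len strict_sorted_list_of_set[of A]
    by (metis linorder_neqE_nat not_less_iff_gr_or_eq sorted_wrt_iff_nth_less)
  have "{y \<in> A. y < x} = (\<lambda>a. sorted_list_of_set A ! a) ` {..<l}"
  proof (intro equalityI subsetI)
    fix y assume "y \<in> {y \<in> A. y < x}"
    then have y: "y \<in> A" "y < x" by auto
    then obtain a where a: "a < card A" "y = sorted_list_of_set A ! a"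
      using assms(1) len by (metis in_set_conv_nth set_sorted_list_of_set)
    then show "y \<in> (\<lambda>a. sorted_list_of_set A ! a) ` {..<l}" using y sm[OF a(1) l] x_def by auto
  next
    fix y assume "y \<in> (\<lambda>a. sorted_list_of_set A ! a) ` {..<l}"
    then obtain a where a: "a < l" "y = sorted_list_of_set A ! a" by auto
    then have "a < card A" using l by simp
    moreover have "y \<in> A" using a \<open>a < card A\<close> assms(1) len by (metis nth_mem set_sorted_list_of_set)
    ultimately show "y \<in> {y \<in> A. y < x}" using sm[OF _ l] a x_def by auto
  qed
  moreover have "inj_on (\<lambda>a. sorted_list_of_set A ! a) {..<l}"
    using l len by (intro inj_onI) (auto simp: nth_eq_iff_index_eq)
  ultimately have "card {y \<in> A. y < x} = l" by (simp add: card_image)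
  then show "bit i l = bit j l" using eq[OF x] by (auto simp: local_spin_def split: if_splits)
qed

lemma spin_configs_finite_card: "finite (spin_configs n) \<and> card (spin_configs n) = 2 ^ n"
proof -
  have "bij_betw (\<lambda>f. vec n f) ({..<n} \<rightarrow>\<^sub>E {-1, 1}) (spin_configs n)"
    unfolding bij_betw_def
  proof (intro conjI inj_onI equalityI subsetI)
    fix f g :: "nat \<Rightarrow> real"
    assume "f \<in> {..<n} \<rightarrow>\<^sub>E {-1, 1}" "g \<in> {..<n} \<rightarrow>\<^sub>E {-1, 1}" and eq: "vec n f = vec n g"
    moreover have "f x = g x" if "x < n" for x using eq that by (metis index_vec)
    ultimately show "f = g" by (intro PiE_ext[of f "{..<n}" "\<lambda>_. {-1, 1}" g]) auto
  next
    fix s :: "real vec" assume "s \<in> vec n ` ({..<n} \<rightarrow>\<^sub>E {-1, 1})"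
    then show "s \<in> spin_configs n" by (fastforce simp: spin_configs_def PiE_iff)
  next
    fix s :: "real vec" assume "s \<in> spin_configs n"
    then have "s = vec n (restrict (($) s) {..<n})" "restrict (($) s) {..<n} \<in> {..<n} \<rightarrow>\<^sub>E {-1, 1}"
      by (auto simp: spin_configs_def intro!: eq_vecI)
    then show "s \<in> vec n ` ({..<n} \<rightarrow>\<^sub>E {-1, 1})" by blast
  qed
  moreover have "finite ({..<n} \<rightarrow>\<^sub>E {-1, 1 :: real})" by (intro finite_PiE) auto
  moreover have "card ({..<n} \<rightarrow>\<^sub>E {-1, 1 :: real}) = 2 ^ n" by (simp add: card_PiE numeral_2_eq_2)
  ultimately show ?thesis by (metis bij_betw_finite bij_betw_same_card)
qed

lemma joint_config_bij:
  assumes A: "A \<subseteq> {..<n}"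
  shows "bij_betw (\<lambda>(i, k). joint_config n A i k)
    ({..<2 ^ card A} \<times> {..<2 ^ card ({..<n} - A)}) (spin_configs n)"
    (is "bij_betw ?f ?D _")
proof -
  have fin: "finite A" "finite ({..<n} - A)" using A finite_subset by auto
  have inj: "inj_on ?f ?D"
  proof (rule inj_onI, clarify)
    fix i k j l :: nat
    assume ik: "i < 2 ^ card A" "k < 2 ^ card ({..<n} - A)"
      "j < 2 ^ card A" "l < 2 ^ card ({..<n} - A)"
      and eq: "joint_config n A i k = joint_config n A j l"
    have e: "joint_config n A i k $ x = joint_config n A j l $ x" for x using eq by simp
    have on: "local_spin A i x = local_spin A j x" if "x \<in> A" for x
      using e[of x] A that by (auto simp: joint_config_def)
    have off: "local_spin ({..<n} - A) k x = local_spin ({..<n} - A) l x" if "x \<in> {..<n} - A" for x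
      using e[of x] that by (auto simp: joint_config_def)
    have "i = j" using on ik by (intro local_spin_inj[OF fin(1)]) auto
    moreover have "k = l" using off ik by (intro local_spin_inj[OF fin(2)]) auto
    ultimately show "i = j \<and> k = l" by simp
  qed
  have sub: "?f ` ?D \<subseteq> spin_configs n"
    by (auto simp: joint_config_def spin_configs_def local_spin_def split: if_splits)
  have "card ?D = 2 ^ n"
    using A card_mono[OF _ A] by (simp add: card_cartesian_product card_Diff_subset fin power_add[symmetric])
  then have "card (?f ` ?D) = card (spin_configs n)"
    using inj by (simp add: card_image spin_configs_finite_card)
  then have "?f ` ?D = spin_configs n"
    using sub spin_configs_finite_card by (intro card_subset_eq) auto
  then show ?thesis using inj by (simp add: bij_betw_def)
qed

definition pure_density :: "(real vec \<Rightarrow> complex) \<Rightarrow> real vec \<Rightarrow> real vec \<Rightarrow> complex" where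
  "pure_density \<psi> s t = \<psi> s * cnj (\<psi> t)"

definition reduced_density ::
  "nat \<Rightarrow> nat set \<Rightarrow> (real vec \<Rightarrow> real vec \<Rightarrow> complex) \<Rightarrow> complex mat" where
  "reduced_density n A \<rho> =
     mat (2 ^ card A) (2 ^ card A)
       (\<lambda>(i, j). \<Sum>k<2 ^ card ({..<n} - A). \<rho> (joint_config n A i k) (joint_config n A j k))"

definition mat_trace :: "'a::comm_monoid_add mat \<Rightarrow> 'a" where
  "mat_trace M = (\<Sum>i<dim_row M. M $$ (i, i))"

definition spectral_decomp :: "complex mat \<Rightarrow> complex mat \<Rightarrow> (nat \<Rightarrow> real) \<Rightarrow> bool" where
  "spectral_decomp M U d \<longleftrightarrow>
     U \<in> carrier_mat (dim_row M) (dim_row M) \<and>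
     mat_adjoint U * U = 1\<^sub>m (dim_row M) \<and>
     M = U * mat_diag (dim_row M) (\<lambda>i. complex_of_real (d i)) * mat_adjoint U"

text \<open>
  Functional calculus for Hermitian matrices. The choice is unambiguous by the lemma
  \<open>spectral_decomp_unique\<close> below.
\<close>

definition hermitian_fun :: "(real \<Rightarrow> real) \<Rightarrow> complex mat \<Rightarrow> complex mat" where
  "hermitian_fun f M =
     (SOME F. \<exists>U d. spectral_decomp M U d \<and>
        F = U * mat_diag (dim_row M) (\<lambda>i. complex_of_real (f (d i))) * mat_adjoint U)"

lemma mat_adjoint_carrier: "U \<in> carrier_mat m k \<Longrightarrow> mat_adjoint U \<in> carrier_mat k m"
  by (auto simp: mat_adjoint_def)

lemma spectral_decomp_unique:
  assumes "spectral_decomp M U d" and "spectral_decomp M V e"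
  shows "U * mat_diag (dim_row M) (\<lambda>i. complex_of_real (f (d i))) * mat_adjoint U =
         V * mat_diag (dim_row M) (\<lambda>i. complex_of_real (f (e i))) * mat_adjoint V"
proof -
  define m where "m = dim_row M"
  define U' V' where "U' = mat_adjoint U" and "V' = mat_adjoint V"
  define D where "D = (\<lambda>g. mat_diag m (\<lambda>i. complex_of_real (g (d i))))"
  define E where "E = (\<lambda>g. mat_diag m (\<lambda>i. complex_of_real (g (e i))))"
  have U: "U \<in> carrier_mat m m" and V: "V \<in> carrier_mat m m" and uu: "U' * U = 1\<^sub>m m"
    and vv: "V' * V = 1\<^sub>m m" and MU: "M = U * D (\<lambda>x. x) * U'" and MV: "M = V * E (\<lambda>x. x) * V'"
    using assms unfolding spectral_decomp_def m_def U'_def V'_def D_def E_def by auto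
  have U': "U' \<in> carrier_mat m m" and V': "V' \<in> carrier_mat m m"
    using U V unfolding U'_def V'_def by (auto intro: mat_adjoint_carrier)
  have D: "D g \<in> carrier_mat m m" and E: "E g \<in> carrier_mat m m" for g
    unfolding D_def E_def by auto
  have UU: "U * U' = 1\<^sub>m m" and VV: "V * V' = 1\<^sub>m m"
    using mat_mult_left_right_inverse[OF U' U uu] mat_mult_left_right_inverse[OF V' V vv] by auto
  define X where "X = V' * U"
  have X: "X \<in> carrier_mat m m" using U V' unfolding X_def by auto
  have l: "P * (Q * R) = P * Q * R" if "P \<in> carrier_mat m m" "Q \<in> carrier_mat m m" "R \<in> carrier_mat m m"
    for P Q R :: "complex mat" using assoc_mult_mat[OF that] by simp
  note c = mult_carrier_mat[of _ m m _ m] U V U' V' D E X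
  have 1: "X * D (\<lambda>x. x) = E (\<lambda>x. x) * X"
  proof -
    have "V' * (U * D (\<lambda>x. x) * U') * U = V' * (V * E (\<lambda>x. x) * V') * U" using MU MV by simp
    moreover have "V' * (U * D (\<lambda>x. x) * U') * U = X * D (\<lambda>x. x) * (U' * U)"
      unfolding X_def by (simp add: c l)
    moreover have "V' * (V * E (\<lambda>x. x) * V') * U = (V' * V) * E (\<lambda>x. x) * X"
      unfolding X_def by (simp add: c l)
    ultimately show ?thesis
      using right_mult_one_mat[of "X * D (\<lambda>x. x)" m m] left_mult_one_mat[OF E, of "\<lambda>x. x"] X D uu vv
      by simp
  qed
  have entry: "X $$ (i, j) * complex_of_real (d j) = complex_of_real (e i) * X $$ (i, j)"
    if "i < m" "j < m" for i j
  proof -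
    have "(X * D (\<lambda>x. x)) $$ (i, j) = (E (\<lambda>x. x) * X) $$ (i, j)" using 1 by simp
    then show ?thesis using that unfolding D_def E_def
      by (simp add: mat_diag_mult_left[OF X] mat_diag_mult_right[OF X])
  qed
  have 2: "X * D f = E f * X"
  proof (rule eq_matI)
    fix i j assume "i < dim_row (E f * X)" "j < dim_col (E f * X)"
    then have ij: "i < m" "j < m" using X E[of f] by auto
    from entry[OF ij] have "X $$ (i, j) = 0 \<or> d j = e i" by auto
    then show "(X * D f) $$ (i, j) = (E f * X) $$ (i, j)" using ij unfolding D_def E_def
      by (auto simp: mat_diag_mult_left[OF X] mat_diag_mult_right[OF X])
  qed (use X D[of f] E[of f] in auto)
  have "U * D f * U' = (V * V') * U * D f * U'" using left_mult_one_mat[OF U] by (simp add: VV)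
  also have "\<dots> = V * (X * D f) * U'" unfolding X_def by (simp add: c l)
  also have "\<dots> = V * E f * V' * (U * U')" unfolding 2 unfolding X_def by (simp add: c l)
  also have "\<dots> = V * E f * V'" unfolding UU
    by (rule right_mult_one_mat[of _ m]) (intro c)
  finally show ?thesis unfolding m_def U'_def V'_def D_def E_def .
qed

lemma hermitian_fun_eq:
  assumes "spectral_decomp M U d"
  shows "hermitian_fun f M =
    U * mat_diag (dim_row M) (\<lambda>i. complex_of_real (f (d i))) * mat_adjoint U"
  unfolding hermitian_fun_def
  by (rule some_equality) (use assms spectral_decomp_unique in blast)+

text \<open>
  \<open>\<rho>\<close> may be singular. The value \<open>ln 0\<close> is irrelevant, because the logarithm is multiplied
  by \<open>\<rho>\<close>; this is the convention \<open>0 log 0 = 0\<close>.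
\<close>

definition von_neumann_entropy :: "complex mat \<Rightarrow> real" where
  "von_neumann_entropy \<rho> = - Re (mat_trace (\<rho> * hermitian_fun ln \<rho>))"

definition entanglement_entropy :: "nat \<Rightarrow> nat set \<Rightarrow> (real vec \<Rightarrow> complex) \<Rightarrow> real" where
  "entanglement_entropy n A \<psi> =
     von_neumann_entropy (reduced_density n A (pure_density \<psi>))"

end

(*
  The first-layer preactivation splits as u(s_A) + c(s_B), where s_B is the part of s outside A,
  so the amplitude is a polynomial of degree at most D = h^d0 in each of the w0 coordinates of
  u(s_A), with coefficients that depend only on s_B. Hence its Schmidt rank is at most
  (D + 1)^w0, and the entropy is at most the logarithm of the rank. The stated bound is weaker,
  because (D + 2) / 2 >= 1. Bounding the degree in each variable instead of the total degree makes
  the count of monomials a product.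
*)
theory Submission
  imports Defs "Jordan_Normal_Form.Spectral_Radius"
begin

section \<open>Spectral decomposition of Hermitian matrices\<close>

lemma index_mat_adjoint:
  "i < dim_col M \<Longrightarrow> j < dim_row M \<Longrightarrow> mat_adjoint M $$ (i, j) = conjugate (M $$ (j, i))"
  by (simp add: mat_adjoint_def mat_of_rows_index)

lemma dim_mat_adjoint [simp]:
  "dim_row (mat_adjoint M) = dim_col M" "dim_col (mat_adjoint M) = dim_row M"
  by (simp_all add: mat_adjoint_def)

lemma mat_adjoint_mult:
  fixes M N :: "complex mat"
  assumes "M \<in> carrier_mat a b" and "N \<in> carrier_mat b c"
  shows "mat_adjoint (M * N) = mat_adjoint N * mat_adjoint M"
proof (rule eq_matI)
  fix i j assume "i < dim_row (mat_adjoint N * mat_adjoint M)" "j < dim_col (mat_adjoint N * mat_adjoint M)"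
  then have ij: "i < c" "j < a" using assms by auto
  then have "mat_adjoint (M * N) $$ (i, j) = cnj (\<Sum>k<b. M $$ (j, k) * N $$ (k, i))"
    using assms by (simp add: index_mat_adjoint scalar_prod_def atLeast0LessThan)
  also have "\<dots> = (mat_adjoint N * mat_adjoint M) $$ (i, j)"
    using ij assms by (simp add: index_mat_adjoint scalar_prod_def atLeast0LessThan mult.commute)
  finally show "mat_adjoint (M * N) $$ (i, j) = (mat_adjoint N * mat_adjoint M) $$ (i, j)" .
qed (use assms in auto)

lemma mat_adjoint_mat_adjoint [simp]: "mat_adjoint (mat_adjoint (M :: complex mat)) = M"
  by (rule eq_matI) (auto simp: index_mat_adjoint)

text \<open>The deflation step of the spectral theorem: an eigenvector is completed to a basis,
  Gram-Schmidt keeps it as first vector, and normalizing the resulting vectors makes them the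
  columns of a unitary matrix.\<close>

lemma unitary_with_eigenvector_column:
  fixes M :: "complex mat"
  assumes M: "M \<in> carrier_mat n n" and ev: "eigenvector M v e"
  obtains W where "W \<in> carrier_mat n n" "mat_adjoint W * W = 1\<^sub>m n"
    "M *\<^sub>v col W 0 = e \<cdot>\<^sub>v col W 0"
proof -
  have v: "v \<in> carrier_vec n" and v0: "v \<noteq> 0\<^sub>v n" and Mv: "M *\<^sub>v v = e \<cdot>\<^sub>v v"
    using ev M unfolding eigenvector_def by auto
  have n: "n > 0" using v v0 by (cases n) auto
  interpret cof_vec_space n "TYPE(complex)" .
  define bs where "bs = basis_completion v"
  define ws where "ws = gram_schmidt n bs"
  note bc = basis_completion[OF v v0, folded bs_def]
  obtain vs where bv: "bs = v # vs" using bc(6,7) n by (cases bs) auto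
  note gs = gram_schmidt_result[OF bc(2,4,5) refl, folded ws_def]
  have ws: "set ws \<subseteq> carrier_vec n" "corthogonal ws" "length ws = n" using gs bc(6) by auto
  have "hd ws = v" unfolding ws_def bv by (rule gram_schmidt_hd[OF v])
  then have ws0: "ws ! 0 = v" using ws(3) n by (cases ws) auto
  have wsc: "ws ! j \<in> carrier_vec n" if "j < n" for j using ws that by auto
  \<comment> \<open>Gram-Schmidt delivers orthogonal but not normalized vectors; \<open>r j\<close>
    is the Euclidean norm of the j-th one.\<close>
  define r where "r j = sqrt (\<Sum>i<n. (cmod (ws ! j $ i))\<^sup>2)" for j
  have sq: "ws ! j \<bullet>c ws ! j = complex_of_real ((r j)\<^sup>2)" if "j < n" for j
    using wsc[OF that] unfolding r_def scalar_prod_def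
    by (simp add: sum_nonneg atLeast0LessThan complex_norm_square del: of_real_power)
  \<comment> \<open>Besides orthogonality, \<open>corthogonal\<close> says that no vector has
    vanishing product with itself, so division by the norms is safe.\<close>
  have r: "r j \<noteq> 0" if "j < n" for j
    using sq[OF that] corthogonalD[OF ws(2), of j j] that ws(3) by auto
  define W where "W = mat n n (\<lambda>(i, j). ws ! j $ i / complex_of_real (r j))"
  have W: "W \<in> carrier_mat n n" by (simp add: W_def)
  have "mat_adjoint W * W = 1\<^sub>m n"
  proof (rule eq_matI)
    fix j k assume "j < dim_row (1\<^sub>m n :: complex mat)" "k < dim_col (1\<^sub>m n :: complex mat)"
    then have jk: "j < n" "k < n" by auto
    have "(mat_adjoint W * W) $$ (j, k) = (\<Sum>i<n. cnj (W $$ (i, j)) * W $$ (i, k))"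
      using jk W by (simp add: index_mat_adjoint scalar_prod_def atLeast0LessThan)
    also have "\<dots> = (\<Sum>i<n. ws ! k $ i * cnj (ws ! j $ i)) / complex_of_real (r j * r k)"
      using jk by (simp add: W_def sum_divide_distrib mult.commute)
    also have "(\<Sum>i<n. ws ! k $ i * cnj (ws ! j $ i)) = ws ! k \<bullet>c ws ! j"
      using wsc[OF jk(1)] wsc[OF jk(2)] by (simp add: scalar_prod_def atLeast0LessThan)
    also have "\<dots> / complex_of_real (r j * r k) = (if j = k then 1 else 0)"
      using corthogonalD[OF ws(2), of k j] jk ws(3) r sq by (auto simp: power2_eq_square)
    finally show "(mat_adjoint W * W) $$ (j, k) = 1\<^sub>m n $$ (j, k)" using jk by simp
  qed (use W in auto)
  moreover have "col W 0 = (1 / complex_of_real (r 0)) \<cdot>\<^sub>v v"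
    using n v by (intro eq_vecI) (auto simp: W_def ws0)
  then have "M *\<^sub>v col W 0 = e \<cdot>\<^sub>v col W 0"
    using M v Mv by (simp add: mult_mat_vec smult_smult_assoc mult.commute)
  ultimately show thesis using that W by blast
qed

text \<open>Induction on the dimension. In a unitary basis starting with an eigenvector the first
  column vanishes below the diagonal; being Hermitian, the matrix then has a first row that vanishes
  as well, and the remaining block \<open>B\<close> is Hermitian of dimension one less.\<close>

lemma hermitian_spectral_decomp:
  assumes "M \<in> carrier_mat n n" and "mat_adjoint M = M"
  shows "\<exists>U d. spectral_decomp M U d"
  using assms
proof (induction n arbitrary: M)
  case 0
  then have "spectral_decomp M (1\<^sub>m 0) (\<lambda>_. 0)"
    unfolding spectral_decomp_def by (auto intro!: eq_matI)
  then show ?case by blast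
next
  case (Suc m)
  let ?n = "Suc m"
  note M = Suc.prems(1) and herm = Suc.prems(2)
  obtain e v where ev: "eigenvector M v e"
    using spectrum_non_empty[OF M] unfolding spectrum_def eigenvalue_def by auto
  obtain W where W: "W \<in> carrier_mat ?n ?n" and WW: "mat_adjoint W * W = 1\<^sub>m ?n"
    and col: "M *\<^sub>v col W 0 = e \<cdot>\<^sub>v col W 0"
    using unitary_with_eigenvector_column[OF M ev] .
  define W' where "W' = mat_adjoint W"
  have W': "W' \<in> carrier_mat ?n ?n" using W unfolding W'_def by (rule mat_adjoint_carrier)
  have WW': "W * W' = 1\<^sub>m ?n" and W'W: "W' * W = 1\<^sub>m ?n"
    using mat_mult_left_right_inverse[OF W' W] WW unfolding W'_def by auto
  \<comment> \<open>\<open>N\<close> is \<open>M\<close> expressed in the basis formed by the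
    columns of \<open>W\<close>.\<close>
  define N where "N = W' * (M * W)"
  have N: "N \<in> carrier_mat ?n ?n" using M W W' unfolding N_def by auto
  have N_herm: "mat_adjoint N = N"
    unfolding N_def W'_def using M W W' herm
    by (simp add: mat_adjoint_mult[of _ ?n ?n _ ?n] mat_adjoint_carrier assoc_mult_mat[of _ ?n ?n _ ?n _ ?n])
  have conj_N: "N $$ (j, i) = cnj (N $$ (i, j))" if "i < ?n" "j < ?n" for i j
    using index_mat_adjoint[of j N i] that N N_herm by auto
  have "col N 0 = W' *\<^sub>v (M *\<^sub>v col W 0)"
    unfolding N_def col_mult2[OF W' mult_carrier_mat[OF M W] zero_less_Suc]
      col_mult2[OF M W zero_less_Suc] ..
  also have "\<dots> = e \<cdot>\<^sub>v col (W' * W) 0"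
    unfolding col unfolding mult_mat_vec[OF W' col_carrier_vec[OF zero_less_Suc W]]
      col_mult2[OF W' W zero_less_Suc] ..
  finally have colN: "col N 0 = e \<cdot>\<^sub>v col (1\<^sub>m ?n) 0" using W'W by simp
  have Ni0: "N $$ (i, 0) = (if i = 0 then e else 0)" if "i < ?n" for i
    using arg_cong[OF colN, of "\<lambda>v. v $ i"] that N by (auto simp: col_def)
  have N0i: "N $$ (0, i) = (if i = 0 then e else 0)" if "i < ?n" for i
    using conj_N[of i 0] Ni0[OF that] conj_N[of 0 0] Ni0[of 0] that by auto
  \<comment> \<open>A diagonal entry of a Hermitian matrix is its own conjugate;
    \<open>spectral_decomp\<close> asks for real eigenvalues.\<close>
  have e: "e = complex_of_real (Re e)"
    using conj_N[of 0 0] Ni0[of 0] by (simp add: complex_eq_iff)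
  define B where "B = mat m m (\<lambda>(i, j). N $$ (Suc i, Suc j))"
  have B: "B \<in> carrier_mat m m" by (simp add: B_def)
  have "mat_adjoint B = B"
    by (rule eq_matI) (auto simp: B_def index_mat_adjoint conj_N[symmetric])
  then obtain V d where Vd: "spectral_decomp B V d" using Suc.IH[OF B] by blast
  define V' where "V' = mat_adjoint V"
  have V: "V \<in> carrier_mat m m" and V'V: "V' * V = 1\<^sub>m m"
    and BV: "B = V * mat_diag m (\<lambda>i. complex_of_real (d i)) * V'"
    using Vd B unfolding spectral_decomp_def V'_def by auto
  have V': "V' \<in> carrier_mat m m" using V unfolding V'_def by (rule mat_adjoint_carrier)
  \<comment> \<open>\<open>ext c X\<close> is the block diagonal matrix with blocks \<open>c\<close>
    and \<open>X\<close>. It is multiplicative, so the decomposition of \<open>B\<close> lifts to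
    one of \<open>N = ext e B\<close>.\<close>
  define ext where "ext c X = four_block_mat (mat 1 1 (\<lambda>_. c)) (0\<^sub>m 1 m) (0\<^sub>m m 1) X"
    for c :: complex and X
  have ext_mult: "ext a X * ext c Y = ext (a * c) (X * Y)"
    if "X \<in> carrier_mat m m" "Y \<in> carrier_mat m m" for a c X Y
    unfolding ext_def using that
    by (subst mult_four_block_mat[of _ 1 1 _ m _ m _ _ 1 _ m])
       (auto intro!: cong_four_block_mat eq_matI simp: scalar_prod_def)
  have ext_carrier: "ext a X \<in> carrier_mat ?n ?n" if "X \<in> carrier_mat m m" for a X
    using four_block_carrier_mat[OF mat_carrier that, of 1 1] unfolding ext_def by simp
  \<comment> \<open>The new eigenvalue takes index 0 and those of the block move up by one.\<close>
  define dd where "dd = case_nat (Re e) d"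
  define D where "D = mat_diag ?n (\<lambda>i. complex_of_real (dd i))"
  have D: "D \<in> carrier_mat ?n ?n" by (simp add: D_def)
  have D_ext: "D = ext e (mat_diag m (\<lambda>i. complex_of_real (d i)))"
    unfolding D_def ext_def dd_def mat_diag_def
    by (rule eq_matI) (auto simp: e[symmetric] split: nat.splits)
  have N_ext: "N = ext e B"
    using N Ni0 N0i unfolding ext_def B_def by (intro eq_matI) auto
  have V'_ext: "mat_adjoint (ext 1 V) = ext 1 V'"
    using V unfolding ext_def V'_def by (intro eq_matI) (auto simp: index_mat_adjoint)
  have N_eq: "N = ext 1 V * D * ext 1 V'"
    unfolding N_ext D_ext using V V' by (simp add: ext_mult BV)
  define U where "U = W * ext 1 V"
  note xV = ext_carrier[OF V, of 1] and xV' = ext_carrier[OF V', of 1]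
  have U: "U \<in> carrier_mat ?n ?n" using W xV unfolding U_def by auto
  have U': "mat_adjoint U = ext 1 V' * W'"
    unfolding U_def mat_adjoint_mult[OF W xV] V'_ext W'_def ..
  note c = mult_carrier_mat[of _ ?n ?n _ ?n] W W' M D xV xV'
  \<comment> \<open>Associativity directed to the left: with the carrier facts \<open>c\<close>, all
    products of square matrices get one normal form. The same device returns in later
    proofs.\<close>
  have l: "P * (Q * R) = P * Q * R" if "P \<in> carrier_mat ?n ?n" "Q \<in> carrier_mat ?n ?n" "R \<in> carrier_mat ?n ?n"
    for P Q R :: "complex mat" using assoc_mult_mat[OF that] by simp
  have "mat_adjoint U * U = ext 1 V' * (W' * W) * ext 1 V"
    unfolding U' unfolding U_def by (simp add: c l)
  also have "\<dots> = ext 1 V' * ext 1 V"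
    unfolding W'W using right_mult_one_mat[OF xV'] by simp
  also have "\<dots> = 1\<^sub>m ?n"
    using V V' unfolding ext_mult[OF V' V] V'V unfolding ext_def by (intro eq_matI) auto
  finally have UU: "mat_adjoint U * U = 1\<^sub>m ?n" .
  \<comment> \<open>Inserting \<open>W * W' = 1\<close> on both sides exposes \<open>N\<close> in
    the middle.\<close>
  have "M = (W * W') * M * (W * W')"
    using left_mult_one_mat[OF M] right_mult_one_mat[OF M] unfolding WW' by simp
  also have "\<dots> = W * N * W'" unfolding N_def by (simp add: c l)
  also have "\<dots> = U * D * mat_adjoint U"
    unfolding N_eq U' unfolding U_def by (simp add: c l)
  finally have "spectral_decomp M U dd"
    using M U UU unfolding spectral_decomp_def D_def by simp
  then show ?case by blast
qed

section \<open>Entropy and rank\<close>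

text \<open>Gaussian elimination, by induction on the equations. Unknowns and coefficients stay
  general in the induction, since each elimination changes both.\<close>

lemma underdetermined_system_nontrivial:
  fixes H :: "'b \<Rightarrow> 'a \<Rightarrow> 'c::field"
  assumes "finite B" and "finite K" and "card B < card K"
  shows "\<exists>v. (\<exists>a\<in>K. v a \<noteq> 0) \<and> (\<forall>\<beta>\<in>B. (\<Sum>a\<in>K. v a * H \<beta> a) = 0)"
  using assms
proof (induction B arbitrary: K H rule: finite_induct)
  case empty
  then have "K \<noteq> {}" by auto
  then show ?case by (intro exI[of _ "\<lambda>_. 1"]) auto
next
  case (insert \<beta> B)
  show ?case
  proof (cases "\<forall>a\<in>K. H \<beta> a = 0")
    case True
    obtain v where "\<exists>a\<in>K. v a \<noteq> 0" "\<forall>\<gamma>\<in>B. (\<Sum>a\<in>K. v a * H \<gamma> a) = 0"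
      using insert.IH[of K H] insert.prems insert.hyps by auto
    with True show ?thesis by (intro exI[of _ v]) auto
  next
    case False
    \<comment> \<open>The new equation has a pivot \<open>p\<close>. Subtracting multiples of it
      removes the unknown \<open>p\<close> from all other equations, which leaves a smaller system
      for the induction hypothesis.\<close>
    then obtain p where p: "p \<in> K" "H \<beta> p \<noteq> 0" by blast
    define K' where "K' = K - {p}"
    have K': "finite K'" "p \<notin> K'" "K = insert p K'" using insert.prems p by (auto simp: K'_def)
    then have "card B < card K'" using insert.prems insert.hyps by simp
    then obtain v where v: "\<exists>a\<in>K'. v a \<noteq> 0"
      "\<forall>\<gamma>\<in>B. (\<Sum>a\<in>K'. v a * (H \<gamma> a - H \<gamma> p * H \<beta> a / H \<beta> p)) = 0"
      using insert.IH[OF K'(1), of "\<lambda>\<gamma> a. H \<gamma> a - H \<gamma> p * H \<beta> a / H \<beta> p"] by blast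
    \<comment> \<open>Back substitution: the value at \<open>p\<close> is the one that solves
      equation \<open>\<beta>\<close>.\<close>
    define w where "w = v(p := - (\<Sum>a\<in>K'. v a * H \<beta> a) / H \<beta> p)"
    have sum_w: "(\<Sum>a\<in>K. w a * H \<gamma> a) = w p * H \<gamma> p + (\<Sum>a\<in>K'. v a * H \<gamma> a)" for \<gamma>
    proof -
      have "(\<Sum>a\<in>K'. w a * H \<gamma> a) = (\<Sum>a\<in>K'. v a * H \<gamma> a)"
        using K' by (intro sum.cong) (auto simp: w_def)
      then show ?thesis using K' by simp
    qed
    have "(\<Sum>a\<in>K. w a * H \<beta> a) = 0" unfolding sum_w using p by (simp add: w_def)
    moreover have "(\<Sum>a\<in>K. w a * H \<gamma> a) = 0" if "\<gamma> \<in> B" for \<gamma>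
    proof -
      have "0 = (\<Sum>a\<in>K'. v a * (H \<gamma> a - H \<gamma> p * H \<beta> a / H \<beta> p))" using v(2) that by simp
      also have "\<dots> = (\<Sum>a\<in>K'. v a * H \<gamma> a - v a * H \<beta> a / H \<beta> p * H \<gamma> p)"
        by (intro sum.cong) (auto simp: algebra_simps)
      also have "\<dots> = (\<Sum>a\<in>K'. v a * H \<gamma> a) - (\<Sum>a\<in>K'. v a * H \<beta> a) / H \<beta> p * H \<gamma> p"
        by (simp only: sum_subtractf sum_distrib_right sum_divide_distrib)
      finally show ?thesis unfolding sum_w by (simp add: w_def)
    qed
    moreover have "\<exists>a\<in>K. w a \<noteq> 0" using v(1) K' by (auto simp: w_def)
    ultimately show ?thesis by blast
  qed
qed

text \<open>Gibbs' inequality against weights \<open>1 / R\<close>: \<open>ln t \<le> t - 1\<close>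
  at \<open>t = 1 / (R * d a)\<close>, multiplied by \<open>d a\<close> and summed over the support
  \<open>S\<close>, bounds the entropy minus \<open>ln R\<close> by
  \<open>card S / R - 1 \<le> 0\<close>.\<close>

lemma shannon_entropy_le_ln_support:
  fixes d :: "'a \<Rightarrow> real"
  assumes "finite I" and nonneg: "\<And>a. a \<in> I \<Longrightarrow> 0 \<le> d a" and total: "(\<Sum>a\<in>I. d a) = 1"
    and supp: "card {a \<in> I. d a \<noteq> 0} \<le> R"
  shows "- (\<Sum>a\<in>I. d a * ln (d a)) \<le> ln (real R)"
proof -
  define S where "S = {a \<in> I. d a \<noteq> 0}"
  have S: "finite S" "S \<subseteq> I" and pos: "\<And>a. a \<in> S \<Longrightarrow> 0 < d a"
    using assms(1) nonneg by (auto simp: S_def less_le)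
  \<comment> \<open>Terms with \<open>d a = 0\<close> contribute nothing to either sum, so both may
    be restricted to the support.\<close>
  have sums: "(\<Sum>a\<in>S. d a) = 1" "(\<Sum>a\<in>S. d a * ln (d a)) = (\<Sum>a\<in>I. d a * ln (d a))"
    unfolding total[symmetric] using assms(1) S(2)
    by (auto simp: S_def intro!: sum.mono_neutral_left)
  have "S \<noteq> {}" using sums(1) by auto
  then have R: "R > 0" using supp S(1) unfolding S_def[symmetric] by (cases R) auto
  have "- (d a * ln (d a)) - d a * ln (real R) \<le> 1 / real R - d a" if "a \<in> S" for a
  proof -
    have "ln (1 / (real R * d a)) \<le> 1 / (real R * d a) - 1"
      using pos[OF that] R by (intro ln_le_minus_one) auto
    then have "d a * ln (1 / (real R * d a)) \<le> d a * (1 / (real R * d a) - 1)"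
      using pos[OF that] by (intro mult_left_mono) auto
    then show ?thesis using pos[OF that] R by (simp add: ln_div ln_mult algebra_simps)
  qed
  then have "(\<Sum>a\<in>S. - (d a * ln (d a)) - d a * ln (real R)) \<le> (\<Sum>a\<in>S. 1 / real R - d a)"
    by (rule sum_mono)
  then have "- (\<Sum>a\<in>S. d a * ln (d a)) - ln (real R) \<le> real (card S) / real R - 1"
    by (simp add: sum_subtractf sum_negf sums(1) flip: sum_distrib_right)
  also have "\<dots> \<le> 0" using supp R by (simp add: S_def)
  finally show ?thesis using sums(2) by simp
qed

section \<open>Entropy through the spectrum and through the rank\<close>

lemma mat_trace_mult_commute:
  assumes "X \<in> carrier_mat n m" and "Y \<in> carrier_mat m n"
  shows "mat_trace (X * Y :: complex mat) = mat_trace (Y * X)"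
  using assms
  by (simp add: mat_trace_def scalar_prod_def atLeast0LessThan mult.commute)
     (rule sum.swap)

text \<open>\<open>\<rho>\<close> and its logarithm are diagonal in the same basis, and cyclicity of
  the trace removes the change of basis.\<close>

lemma von_neumann_entropy_spectral:
  assumes "spectral_decomp \<rho> U d"
  shows "von_neumann_entropy \<rho> = - (\<Sum>a<dim_row \<rho>. d a * ln (d a))"
proof -
  define n U' where "n = dim_row \<rho>" and "U' = mat_adjoint U"
  define D L where "D = mat_diag n (\<lambda>i. complex_of_real (d i))"
    and "L = mat_diag n (\<lambda>i. complex_of_real (ln (d i)))"
  have U: "U \<in> carrier_mat n n" and UU: "U' * U = 1\<^sub>m n" and \<rho>: "\<rho> = U * D * U'"
    using assms unfolding spectral_decomp_def n_def U'_def D_def by auto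
  have L': "hermitian_fun ln \<rho> = U * L * U'"
    using hermitian_fun_eq[OF assms] unfolding n_def U'_def L_def .
  have U': "U' \<in> carrier_mat n n" using U unfolding U'_def by (rule mat_adjoint_carrier)
  have D: "D \<in> carrier_mat n n" and L: "L \<in> carrier_mat n n" unfolding D_def L_def by auto
  note c = mult_carrier_mat[of _ n n _ n] U U' D L
  have l: "P * (Q * R) = P * Q * R" if "P \<in> carrier_mat n n" "Q \<in> carrier_mat n n" "R \<in> carrier_mat n n"
    for P Q R :: "complex mat" using assoc_mult_mat[OF that] by simp
  have "\<rho> * hermitian_fun ln \<rho> = U * D * (U' * U) * L * U'"
    unfolding L' unfolding \<rho> by (simp add: c l)
  also have "\<dots> = U * (D * L) * U'"
    unfolding UU using right_mult_one_mat[of "U * D" n n] by (simp add: c l)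
  finally have "mat_trace (\<rho> * hermitian_fun ln \<rho>) = mat_trace (U' * (U * (D * L)))"
    using mat_trace_mult_commute[of "U * (D * L)" n n U'] by (simp add: c)
  also have "U' * (U * (D * L)) = D * L"
  proof -
    have "U' * (U * (D * L)) = (U' * U) * (D * L)" by (simp add: c l)
    also have "\<dots> = D * L" unfolding UU using left_mult_one_mat[of "D * L" n n] by (simp add: c)
    finally show ?thesis .
  qed
  also have "mat_trace (D * L) = (\<Sum>a<n. complex_of_real (d a * ln (d a)))"
    unfolding D_def L_def mat_diag_diag by (simp add: mat_trace_def mat_diag_def)
  finally show ?thesis by (simp add: von_neumann_entropy_def n_def flip: of_real_sum of_real_mult)
qed

text \<open>
  In the eigenbasis \<open>U\<close> of \<open>\<rho>\<close> the rows \<open>T a\<close> of \<open>U\<^sup>* M\<close> are orthogonal with squared norms the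
  eigenvalues \<open>d a\<close>. They lie in the span of the \<open>G \<beta>\<close>, so at most \<open>card B\<close> of them are non-zero.
\<close>

lemma von_neumann_entropy_le_ln_rank:
  fixes M :: "nat \<Rightarrow> nat \<Rightarrow> complex"
  assumes \<rho>: "\<rho> = mat n n (\<lambda>(i, j). \<Sum>k<m. M i k * cnj (M j k))"
    and total: "(\<Sum>i<n. \<Sum>k<m. (cmod (M i k))\<^sup>2) = 1"
    and B: "finite B"
    and fact: "\<And>i k. i < n \<Longrightarrow> k < m \<Longrightarrow> M i k = (\<Sum>\<beta>\<in>B. F i \<beta> * G \<beta> k)"
  shows "von_neumann_entropy \<rho> \<le> ln (real (card B))"
proof -
  have \<rho>_carrier: "\<rho> \<in> carrier_mat n n" by (simp add: \<rho>)
  have "mat_adjoint \<rho> = \<rho>"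
    by (rule eq_matI) (auto simp: \<rho> index_mat_adjoint mult.commute)
  then obtain U d where Ud: "spectral_decomp \<rho> U d" using hermitian_spectral_decomp \<rho>_carrier by blast
  define U' where "U' = mat_adjoint U"
  define D where "D = mat_diag n (\<lambda>i. complex_of_real (d i))"
  have U: "U \<in> carrier_mat n n" and UU: "U' * U = 1\<^sub>m n" and \<rho>U: "\<rho> = U * D * U'"
    using Ud \<rho>_carrier unfolding spectral_decomp_def U'_def D_def by auto
  have U': "U' \<in> carrier_mat n n" using U unfolding U'_def by (rule mat_adjoint_carrier)
  have D: "D \<in> carrier_mat n n" unfolding D_def by auto
  note c = mult_carrier_mat[of _ n n _ n] U U' D
  have l: "P * (Q * R) = P * Q * R" if "P \<in> carrier_mat n n" "Q \<in> carrier_mat n n" "R \<in> carrier_mat n n"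
    for P Q R :: "complex mat" using assoc_mult_mat[OF that] by simp
  have D_eq: "U' * \<rho> * U = D"
  proof -
    have "U' * \<rho> * U = (U' * U) * D * (U' * U)" unfolding \<rho>U by (simp add: c l)
    then show ?thesis unfolding UU using left_mult_one_mat[OF D] right_mult_one_mat[OF D] by simp
  qed
  define T where "T a k = (\<Sum>i<n. cnj (U $$ (i, a)) * M i k)" for a k
  \<comment> \<open>This is entry \<open>(a, b)\<close> of \<open>U' * \<rho> * U = D\<close>, with
    \<open>\<rho>\<close> expanded as \<open>M\<close> times its adjoint and the sum over
    \<open>k\<close> moved outside.\<close>
  have T: "(\<Sum>k<m. T a k * cnj (T b k)) = (if a = b then complex_of_real (d a) else 0)"
    if "a < n" "b < n" for a b
  proof -
    have "D $$ (a, b) = (\<Sum>j<n. (\<Sum>i<n. cnj (U $$ (i, a)) * \<rho> $$ (i, j)) * U $$ (j, b))"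
      using that U \<rho>_carrier U' unfolding D_eq[symmetric]
      by (simp add: scalar_prod_def atLeast0LessThan U'_def index_mat_adjoint del: assoc_mult_mat)
    also have "\<dots> = (\<Sum>j<n. \<Sum>i<n. \<Sum>k<m. cnj (U $$ (i, a)) * M i k * (U $$ (j, b) * cnj (M j k)))"
      by (simp add: \<rho> sum_distrib_left sum_distrib_right mult_ac)
    also have "\<dots> = (\<Sum>j<n. \<Sum>k<m. \<Sum>i<n. cnj (U $$ (i, a)) * M i k * (U $$ (j, b) * cnj (M j k)))"
      by (intro sum.cong refl sum.swap)
    also have "\<dots> = (\<Sum>k<m. \<Sum>j<n. \<Sum>i<n. cnj (U $$ (i, a)) * M i k * (U $$ (j, b) * cnj (M j k)))"
      by (rule sum.swap)
    also have "\<dots> = (\<Sum>k<m. T a k * cnj (T b k))"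
      by (simp add: T_def sum_distrib_left sum_distrib_right)
    finally have "(\<Sum>k<m. T a k * cnj (T b k)) = D $$ (a, b)" ..
    then show ?thesis using that by (simp add: D_def mat_diag_def)
  qed
  have "0 \<le> d a" if "a < n" for a
  proof -
    have "complex_of_real (d a) = complex_of_real (\<Sum>k<m. (cmod (T a k))\<^sup>2)"
      using T[OF that that] by (simp add: complex_norm_square del: of_real_power)
    then have "d a = (\<Sum>k<m. (cmod (T a k))\<^sup>2)" unfolding of_real_eq_iff .
    then show ?thesis by (simp add: sum_nonneg)
  qed
  \<comment> \<open>The eigenvalues sum to the trace of \<open>\<rho>\<close>, which is the squared
    norm of the state.\<close>
  moreover have "(\<Sum>a<n. d a) = 1"
  proof -
    have "complex_of_real (\<Sum>a<n. d a) = mat_trace (U' * (\<rho> * U))"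
      using D_eq assoc_mult_mat[OF U' \<rho>_carrier U] by (simp add: D_def mat_trace_def mat_diag_def)
    also have "\<dots> = mat_trace (\<rho> * U * U')"
      using U' U \<rho>_carrier by (intro mat_trace_mult_commute) auto
    also have "\<rho> * U * U' = \<rho>"
      using mat_mult_left_right_inverse[OF U' U UU] assoc_mult_mat[OF \<rho>_carrier U U']
        right_mult_one_mat[OF \<rho>_carrier] by simp
    also have "mat_trace \<rho> = complex_of_real (\<Sum>i<n. \<Sum>k<m. (cmod (M i k))\<^sup>2)"
      by (simp add: \<rho> mat_trace_def complex_norm_square del: of_real_power)
    finally show ?thesis unfolding total of_real_eq_iff .
  qed
  moreover have "card {a \<in> {..<n}. d a \<noteq> 0} \<le> card B"
  proof (rule ccontr)
    define K where "K = {a \<in> {..<n}. d a \<noteq> 0}"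
    \<comment> \<open>\<open>H \<beta> a\<close> are the coefficients of row \<open>T a\<close> in
      terms of the \<open>G \<beta>\<close>. With more rows in \<open>K\<close> than elements of
      \<open>B\<close>, some nontrivial \<open>v\<close> annihilates all of them and hence is a
      linear relation among the rows.\<close>
    define H where "H \<beta> a = (\<Sum>i<n. cnj (U $$ (i, a)) * F i \<beta>)" for \<beta> a
    assume "\<not> card {a \<in> {..<n}. d a \<noteq> 0} \<le> card B"
    then obtain v where v: "\<exists>a\<in>K. v a \<noteq> 0" "\<And>\<beta>. \<beta> \<in> B \<Longrightarrow> (\<Sum>a\<in>K. v a * H \<beta> a) = 0"
      using underdetermined_system_nontrivial[OF B, of K H] unfolding K_def by auto
    have TH: "T a k = (\<Sum>\<beta>\<in>B. H \<beta> a * G \<beta> k)" if "k < m" for a k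
      unfolding T_def H_def sum_distrib_right
      by (subst sum.swap) (simp add: fact that sum_distrib_left mult_ac)
    have vT: "(\<Sum>a\<in>K. v a * T a k) = 0" if "k < m" for k
    proof -
      have "(\<Sum>a\<in>K. v a * T a k) = (\<Sum>a\<in>K. \<Sum>\<beta>\<in>B. v a * H \<beta> a * G \<beta> k)"
        by (simp add: TH[OF that] sum_distrib_left mult_ac)
      also have "\<dots> = (\<Sum>\<beta>\<in>B. (\<Sum>a\<in>K. v a * H \<beta> a) * G \<beta> k)"
        unfolding sum_distrib_right by (rule sum.swap)
      finally show ?thesis using v(2) by simp
    qed
    obtain b where b: "b \<in> K" "v b \<noteq> 0" using v(1) by blast
    \<comment> \<open>The relation is paired with the row \<open>T b\<close>. By orthogonality only
      \<open>v b * d b\<close> survives, and both factors are nonzero.\<close>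
    have "0 = (\<Sum>k<m. (\<Sum>a\<in>K. v a * T a k) * cnj (T b k))" using vT by simp
    also have "\<dots> = (\<Sum>a\<in>K. v a * (\<Sum>k<m. T a k * cnj (T b k)))"
      unfolding sum_distrib_right sum_distrib_left by (subst sum.swap) (simp add: mult_ac)
    also have "\<dots> = (\<Sum>a\<in>K. if a = b then v a * complex_of_real (d a) else 0)"
      using b by (intro sum.cong) (auto simp: T K_def)
    also have "\<dots> = v b * complex_of_real (d b)" using b by (simp add: K_def)
    finally show False using b by (simp add: K_def)
  qed
  ultimately show ?thesis
    unfolding von_neumann_entropy_spectral[OF Ud] using \<rho>_carrier
    by (intro shannon_entropy_le_ln_support) auto
qed

section \<open>Schmidt rank of perceptron states\<close>

text \<open>
  \<open>f x y\<close> is a polynomial of degree at most \<open>D\<close> in each of \<open>u 0 x, \<dots>, u (w - 1) x\<close> with coefficients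
  depending only on \<open>y\<close>. There are \<open>(D + 1) ^ w\<close> monomials, which bounds the rank of \<open>f\<close> as a matrix.
\<close>

definition bipartite_poly :: "nat \<Rightarrow> (nat \<Rightarrow> 'a \<Rightarrow> real) \<Rightarrow> nat \<Rightarrow> ('a \<Rightarrow> 'b \<Rightarrow> real) \<Rightarrow> bool" where
  "bipartite_poly w u D f \<longleftrightarrow>
     (\<exists>g. \<forall>x y. f x y = (\<Sum>\<beta>\<in>{..<w} \<rightarrow>\<^sub>E {..D}. (\<Prod>j<w. u j x ^ \<beta> j) * g \<beta> y))"

text \<open>Frees later proofs from the canonical index set: distinct indices \<open>t\<close> may
  carry the same exponents, and the coefficients of equal monomials are added up.\<close>

lemma bipartite_polyI:
  assumes T: "finite T" and \<phi>: "\<And>t j. t \<in> T \<Longrightarrow> j < w \<Longrightarrow> \<phi> t j \<le> D"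
    and f: "\<And>x y. f x y = (\<Sum>t\<in>T. (\<Prod>j<w. u j x ^ \<phi> t j) * G t y)"
  shows "bipartite_poly w u D f"
proof -
  \<comment> \<open>Restriction makes exponent functions that agree below \<open>w\<close> equal and
    puts them into the extensional function space.\<close>
  define r where "r t = restrict (\<phi> t) {..<w}" for t
  have r: "r ` T \<subseteq> {..<w} \<rightarrow>\<^sub>E {..D}" using \<phi> unfolding r_def by (intro image_subsetI) (auto simp: restrict_PiE_iff)
  have fin: "finite ({..<w} \<rightarrow>\<^sub>E {..D})" by (intro finite_PiE) auto
  have "f x y = (\<Sum>\<beta>\<in>{..<w} \<rightarrow>\<^sub>E {..D}. (\<Prod>j<w. u j x ^ \<beta> j) * (\<Sum>t\<in>{t \<in> T. r t = \<beta>}. G t y))" for x y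
  proof -
    have "f x y = (\<Sum>t\<in>T. (\<Prod>j<w. u j x ^ r t j) * G t y)"
      unfolding f by (simp add: r_def)
    also have "\<dots> = (\<Sum>\<beta>\<in>{..<w} \<rightarrow>\<^sub>E {..D}. \<Sum>t\<in>{t \<in> T. r t = \<beta>}. (\<Prod>j<w. u j x ^ r t j) * G t y)"
      by (rule sum.group[OF T fin r, symmetric])
    also have "\<dots> = (\<Sum>\<beta>\<in>{..<w} \<rightarrow>\<^sub>E {..D}. (\<Prod>j<w. u j x ^ \<beta> j) * (\<Sum>t\<in>{t \<in> T. r t = \<beta>}. G t y))"
      unfolding sum_distrib_left by (intro sum.cong) auto
    finally show ?thesis .
  qed
  then show ?thesis unfolding bipartite_poly_def
    by (intro exI[of _ "\<lambda>\<beta> y. \<Sum>t\<in>{t \<in> T. r t = \<beta>}. G t y"]) simp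
qed

section \<open>Closure properties of bipartite polynomials\<close>

lemma bipartite_poly_mono:
  assumes "bipartite_poly w u D f" and "D \<le> E"
  shows "bipartite_poly w u E f"
proof -
  obtain g where "\<And>x y. f x y = (\<Sum>\<beta>\<in>{..<w} \<rightarrow>\<^sub>E {..D}. (\<Prod>j<w. u j x ^ \<beta> j) * g \<beta> y)"
    using assms(1) unfolding bipartite_poly_def by blast
  then show ?thesis using assms(2)
    by (intro bipartite_polyI[where T = "{..<w} \<rightarrow>\<^sub>E {..D}" and \<phi> = "\<lambda>\<beta>. \<beta>" and G = g])
       (auto intro!: finite_PiE dest!: PiE_mem)
qed

lemma bipartite_poly_affine_coord:
  assumes "j < w"
  shows "bipartite_poly w u 1 (\<lambda>x y. u j x + c y)"
\<comment> \<open>Two monomials: \<open>True\<close> stands for \<open>u j\<close> with coefficient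
  1, \<open>False\<close> for the constant monomial, whose coefficient \<open>c y\<close> carries
  the dependence on the second argument.\<close>
proof (rule bipartite_polyI[where T = "UNIV :: bool set"
      and \<phi> = "\<lambda>t i. if t \<and> i = j then 1 else 0" and G = "\<lambda>t y. if t then 1 else c y"])
  have "(\<Prod>i<w. u i x ^ (if i = j then 1 else 0)) = u j x" for x
    using assms by (simp add: if_distrib prod.delta cong: if_cong)
  then show "u j x + c y = (\<Sum>t\<in>UNIV. (\<Prod>i<w. u i x ^ (if t \<and> i = j then 1 else 0)) * (if t then 1 else c y))"
    for x y by (simp add: UNIV_bool)
qed auto

lemma bipartite_poly_const: "bipartite_poly w u D (\<lambda>x y. c)"
  by (rule bipartite_polyI[where T = "{()}" and \<phi> = "\<lambda>_ _. 0" and G = "\<lambda>_ _. c"]) auto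

lemma bipartite_poly_add:
  assumes "bipartite_poly w u D f" and "bipartite_poly w u D f'"
  shows "bipartite_poly w u D (\<lambda>x y. f x y + f' x y)"
proof -
  obtain g where "\<And>x y. f x y = (\<Sum>\<beta>\<in>{..<w} \<rightarrow>\<^sub>E {..D}. (\<Prod>j<w. u j x ^ \<beta> j) * g \<beta> y)"
    using assms(1) unfolding bipartite_poly_def by blast
  moreover obtain g' where "\<And>x y. f' x y = (\<Sum>\<beta>\<in>{..<w} \<rightarrow>\<^sub>E {..D}. (\<Prod>j<w. u j x ^ \<beta> j) * g' \<beta> y)"
    using assms(2) unfolding bipartite_poly_def by blast
  ultimately show ?thesis unfolding bipartite_poly_def
    by (intro exI[of _ "\<lambda>\<beta> y. g \<beta> y + g' \<beta> y"]) (simp add: distrib_left sum.distrib)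
qed

lemma bipartite_poly_mult:
  assumes "bipartite_poly w u D f" and "bipartite_poly w u E f'"
  shows "bipartite_poly w u (D + E) (\<lambda>x y. f x y * f' x y)"
proof -
  obtain g where g: "\<And>x y. f x y = (\<Sum>\<beta>\<in>{..<w} \<rightarrow>\<^sub>E {..D}. (\<Prod>j<w. u j x ^ \<beta> j) * g \<beta> y)"
    using assms(1) unfolding bipartite_poly_def by blast
  obtain g' where g': "\<And>x y. f' x y = (\<Sum>\<beta>\<in>{..<w} \<rightarrow>\<^sub>E {..E}. (\<Prod>j<w. u j x ^ \<beta> j) * g' \<beta> y)"
    using assms(2) unfolding bipartite_poly_def by blast
  show ?thesis
  \<comment> \<open>Expanding the product gives pairs of exponent functions, and exponents add
    variable by variable.\<close>
  proof (rule bipartite_polyI[where T = "({..<w} \<rightarrow>\<^sub>E {..D}) \<times> ({..<w} \<rightarrow>\<^sub>E {..E})"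
        and \<phi> = "\<lambda>(\<beta>, \<gamma>) j. \<beta> j + \<gamma> j" and G = "\<lambda>(\<beta>, \<gamma>) y. g \<beta> y * g' \<gamma> y"])
    show "f x y * f' x y =
      (\<Sum>t\<in>({..<w} \<rightarrow>\<^sub>E {..D}) \<times> ({..<w} \<rightarrow>\<^sub>E {..E}).
        (\<Prod>j<w. u j x ^ (case t of (\<beta>, \<gamma>) \<Rightarrow> \<lambda>j. \<beta> j + \<gamma> j) j) * (case t of (\<beta>, \<gamma>) \<Rightarrow> \<lambda>y. g \<beta> y * g' \<gamma> y) y)"
      for x y
      unfolding g g' sum_product sum.cartesian_product
      by (rule sum.cong[OF refl]) (simp add: case_prod_unfold power_add prod.distrib)
  next
    fix t j assume t: "t \<in> ({..<w} \<rightarrow>\<^sub>E {..D}) \<times> ({..<w} \<rightarrow>\<^sub>E {..E})" and j: "j < w"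
    obtain \<beta> \<gamma> where "t = (\<beta>, \<gamma>)" by fastforce
    then show "(case t of (\<beta>, \<gamma>) \<Rightarrow> \<lambda>j. \<beta> j + \<gamma> j) j \<le> D + E"
      using t j PiE_mem[of \<beta> "{..<w}" "\<lambda>_. {..D}" j] PiE_mem[of \<gamma> "{..<w}" "\<lambda>_. {..E}" j]
      by auto
  qed (auto intro!: finite_PiE)
qed

lemma bipartite_poly_cmult:
  "bipartite_poly w u D f \<Longrightarrow> bipartite_poly w u D (\<lambda>x y. c * f x y)"
  using bipartite_poly_mult[OF bipartite_poly_const[of w u 0 c], of D f] by simp

lemma bipartite_poly_sum:
  assumes "finite I" and "\<And>i. i \<in> I \<Longrightarrow> bipartite_poly w u D (f i)"
  shows "bipartite_poly w u D (\<lambda>x y. \<Sum>i\<in>I. f i x y)"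
  using assms
  by (induction I rule: finite_induct) (auto intro: bipartite_poly_const bipartite_poly_add)

lemma bipartite_poly_power:
  "bipartite_poly w u D f \<Longrightarrow> bipartite_poly w u (k * D) (\<lambda>x y. f x y ^ k)"
  by (induction k) (auto intro: bipartite_poly_const bipartite_poly_mult)

text \<open>The effect of one nonlinearity, and the source of the power \<open>h ^ d0\<close>. Lower
  powers of \<open>f\<close> have smaller degree and are raised to the common bound by
  monotonicity.\<close>

lemma bipartite_poly_poly:
  assumes "bipartite_poly w u D f" and "degree p \<le> h"
  shows "bipartite_poly w u (h * D) (\<lambda>x y. poly p (f x y))"
  unfolding poly_altdef
proof (intro bipartite_poly_sum bipartite_poly_cmult)
  fix i assume "i \<in> {..degree p}"
  then have "i * D \<le> h * D" using assms(2) by auto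
  then show "bipartite_poly w u (h * D) (\<lambda>x y. f x y ^ i)"
    using bipartite_poly_power[OF assms(1)] bipartite_poly_mono by blast
qed simp

text \<open>Used for the preactivations after the first layer and for the readout: weights and bias
  depend on neither argument, so the degree does not grow.\<close>

lemma bipartite_poly_affine:
  assumes "v \<in> carrier_vec m" and "\<And>x y. s x y \<in> carrier_vec m"
    and "\<And>j. j < m \<Longrightarrow> bipartite_poly w u D (\<lambda>x y. s x y $ j)"
  shows "bipartite_poly w u D (\<lambda>x y. v \<bullet> s x y + c)"
proof -
  have "v \<bullet> s x y = (\<Sum>j<m. v $ j * s x y $ j)" for x y
    using assms(2)[of x y] by (simp add: scalar_prod_def atLeast0LessThan)
  then show ?thesis using assms(3)
    by (auto intro!: bipartite_poly_add bipartite_poly_sum bipartite_poly_cmult bipartite_poly_const)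
qed

section \<open>Perceptron amplitudes and their entropy\<close>

text \<open>Only the first layer sees the spins, and its preactivations have degree 1 in
  \<open>u\<close>; each nonlinearity multiplies the degree by \<open>h\<close>. The induction
  therefore starts at layer 1. The dimension claim is carried along so that the affine maps of later
  layers can be expanded.\<close>

lemma bipartite_poly_mlp_hidden:
  fixes W :: "nat \<Rightarrow> real mat" and A :: "nat set"
  assumes A: "A \<subseteq> {..<n}" and p: "degree p \<le> h"
    and W1: "W 1 \<in> carrier_mat w n"
    and W: "\<And>l. 2 \<le> l \<Longrightarrow> l \<le> d \<Longrightarrow> W l \<in> carrier_mat w w"
    and b: "\<And>l. 1 \<le> l \<Longrightarrow> l \<le> d \<Longrightarrow> b l \<in> carrier_vec w"
    and l: "1 \<le> l" "l \<le> d"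
  defines "u \<equiv> \<lambda>j i. \<Sum>x\<in>A. W 1 $$ (j, x) * local_spin A i x"
  shows "(\<forall>i k. mlp_hidden (poly p) W b (joint_config n A i k) l \<in> carrier_vec w) \<and>
    (\<forall>j<w. bipartite_poly w u (h ^ l) (\<lambda>i k. mlp_hidden (poly p) W b (joint_config n A i k) l $ j))"
    (is "?carrier l \<and> ?sep l")
  using l
proof (induction l rule: dec_induct)
  case base
  have s: "joint_config n A i k \<in> carrier_vec n" for i k by (simp add: joint_config_def)
  have "bipartite_poly w u (h ^ 1) (\<lambda>i k. mlp_hidden (poly p) W b (joint_config n A i k) 1 $ j)"
    if j: "j < w" for j
  proof -
    \<comment> \<open>Everything in the preactivation of neuron \<open>j\<close> that does not
      depend on the spins in \<open>A\<close>: the other spins and the bias.\<close>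
    define c where "c k = (\<Sum>x\<in>{..<n} - A. W 1 $$ (j, x) * local_spin ({..<n} - A) k x) + b 1 $ j" for k
    have "(W 1 *\<^sub>v joint_config n A i k + b 1) $ j = u j i + c k" for i k
    proof -
      have "(W 1 *\<^sub>v joint_config n A i k + b 1) $ j =
          (\<Sum>x<n. W 1 $$ (j, x) * joint_config n A i k $ x) + b 1 $ j"
        using W1 s b[of 1] base j by (simp add: scalar_prod_def atLeast0LessThan joint_config_def)
      also have "(\<Sum>x<n. W 1 $$ (j, x) * joint_config n A i k $ x) =
          (\<Sum>x\<in>{..<n} - A. W 1 $$ (j, x) * joint_config n A i k $ x) +
          (\<Sum>x\<in>A. W 1 $$ (j, x) * joint_config n A i k $ x)"
        using A by (intro sum.subset_diff) auto
      also have "(\<Sum>x\<in>A. W 1 $$ (j, x) * joint_config n A i k $ x) = u j i"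
        using A unfolding u_def by (intro sum.cong) (auto simp: joint_config_def)
      also have "(\<Sum>x\<in>{..<n} - A. W 1 $$ (j, x) * joint_config n A i k $ x) + u j i + b 1 $ j = u j i + c k"
        unfolding c_def by (auto simp: joint_config_def intro!: sum.cong)
      finally show ?thesis .
    qed
    moreover have "dim_vec (b 1) = w" using b[of 1] base by auto
    ultimately have "mlp_hidden (poly p) W b (joint_config n A i k) 1 $ j = poly p (u j i + c k)" for i k
      using j by simp
    then show ?thesis
      using bipartite_poly_poly[OF bipartite_poly_affine_coord[OF j] p] by simp
  qed
  moreover have "W 1 *\<^sub>v joint_config n A i k + b 1 \<in> carrier_vec w" for i k
    using W1 s b[of 1] base by (intro add_carrier_vec mult_mat_vec_carrier) auto
  ultimately show ?case by simp
next
  case (step l)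
  then have IH: "?carrier l" "?sep l" by auto
  have Wl: "W (Suc l) \<in> carrier_mat w w" and bl: "b (Suc l) \<in> carrier_vec w"
    using W[of "Suc l"] b[of "Suc l"] step by auto
  have "bipartite_poly w u (h ^ Suc l)
      (\<lambda>i k. mlp_hidden (poly p) W b (joint_config n A i k) (Suc l) $ j)" if j: "j < w" for j
  proof -
    have "bipartite_poly w u (h ^ l)
        (\<lambda>i k. row (W (Suc l)) j \<bullet> mlp_hidden (poly p) W b (joint_config n A i k) l + b (Suc l) $ j)"
      using IH Wl j by (intro bipartite_poly_affine[where m = w]) auto
    from bipartite_poly_poly[OF this p] show ?thesis using Wl bl j by simp
  qed
  moreover have "W (Suc l) *\<^sub>v mlp_hidden (poly p) W b (joint_config n A i k) l + b (Suc l)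
      \<in> carrier_vec w" for i k
    using Wl bl IH(1) by (intro add_carrier_vec mult_mat_vec_carrier) auto
  ultimately show ?case by simp
qed

text \<open>Real and imaginary parts share the same monomials, so their coefficients merge into
  complex ones and the rank bound \<open>(D + 1) ^ w\<close> does not double.\<close>

lemma entanglement_entropy_le_of_bipartite_poly:
  assumes A: "A \<subseteq> {..<n}" and nz: "\<exists>s\<in>spin_configs n. \<Psi> s \<noteq> 0"
    and R: "bipartite_poly w u D (\<lambda>i k. Re (\<Psi> (joint_config n A i k)))"
    and I: "bipartite_poly w u D (\<lambda>i k. Im (\<Psi> (joint_config n A i k)))"
  shows "entanglement_entropy n A (normalize_state n \<Psi>) \<le> real w * ln (real D + 1)"
proof -
  define \<psi> where "\<psi> = normalize_state n \<Psi>"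
  define Z where "Z = (\<Sum>t\<in>spin_configs n. (cmod (\<Psi> t))\<^sup>2)"
  define B where "B = {..<w} \<rightarrow>\<^sub>E {..D}"
  have "Z > 0" using nz spin_configs_finite_card unfolding Z_def
    by (auto intro!: sum_pos2)
  have \<psi>: "\<psi> s = \<Psi> s / complex_of_real (sqrt Z)" for s
    by (simp add: \<psi>_def normalize_state_def Z_def)
  \<comment> \<open>Summing over both halves of the system is summing over all configurations, so
    normalization gives total weight 1.\<close>
  have "(\<Sum>i<2 ^ card A. \<Sum>k<2 ^ card ({..<n} - A). (cmod (\<psi> (joint_config n A i k)))\<^sup>2) =
      (\<Sum>s\<in>spin_configs n. (cmod (\<psi> s))\<^sup>2)"
    unfolding sum.cartesian_product
    using sum.reindex_bij_betw[OF joint_config_bij[OF A], of "\<lambda>s. (cmod (\<psi> s))\<^sup>2"]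
    by (simp add: case_prod_unfold)
  also have "\<dots> = (\<Sum>s\<in>spin_configs n. (cmod (\<Psi> s))\<^sup>2) / Z"
    using \<open>Z > 0\<close> by (simp add: \<psi> norm_divide power_divide sum_divide_distrib)
  also have "\<dots> = 1" using \<open>Z > 0\<close> by (simp add: Z_def)
  finally have total: "(\<Sum>i<2 ^ card A. \<Sum>k<2 ^ card ({..<n} - A). (cmod (\<psi> (joint_config n A i k)))\<^sup>2) = 1" .
  obtain gR where gR:
    "\<And>i k. Re (\<Psi> (joint_config n A i k)) = (\<Sum>\<beta>\<in>B. (\<Prod>j<w. u j i ^ \<beta> j) * gR \<beta> k)"
    using R unfolding bipartite_poly_def B_def by blast
  obtain gI where gI:
    "\<And>i k. Im (\<Psi> (joint_config n A i k)) = (\<Sum>\<beta>\<in>B. (\<Prod>j<w. u j i ^ \<beta> j) * gI \<beta> k)"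
    using I unfolding bipartite_poly_def B_def by blast
  have fact: "\<psi> (joint_config n A i k) = (\<Sum>\<beta>\<in>B.
      complex_of_real (\<Prod>j<w. u j i ^ \<beta> j) * (Complex (gR \<beta> k) (gI \<beta> k) / complex_of_real (sqrt Z)))" for i k
  proof -
    have "\<Psi> (joint_config n A i k) =
        (\<Sum>\<beta>\<in>B. complex_of_real (\<Prod>j<w. u j i ^ \<beta> j) * Complex (gR \<beta> k) (gI \<beta> k))"
      by (simp add: complex_eq_iff gR gI del: of_real_prod of_real_power)
    then show ?thesis unfolding \<psi> by (simp add: sum_divide_distrib)
  qed
  have "entanglement_entropy n A \<psi> \<le> ln (real (card B))"
    unfolding entanglement_entropy_def
    by (rule von_neumann_entropy_le_ln_rank[OF _ total _ fact])
       (auto simp: reduced_density_def pure_density_def B_def intro!: finite_PiE)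
  also have "card B = (D + 1) ^ w" by (simp add: B_def card_PiE)
  also have "ln (real ((D + 1) ^ w)) = real w * ln (real D + 1)"
    by (simp add: ln_realpow add.commute)
  finally show ?thesis by (simp add: \<psi>_def)
qed

theorem mainTheorem3:
  fixes n w0 d0 h :: nat
    and \<sigma> :: "real \<Rightarrow> real" and p :: "real poly"
    and W :: "nat \<Rightarrow> real mat" and b :: "nat \<Rightarrow> real vec"
    and wR wI :: "real vec" and bR bI :: real
    and \<Psi> :: "real vec \<Rightarrow> complex"
    and A :: "nat set"
  assumes "w0 \<ge> 1" and "d0 \<ge> 1" and "h \<ge> 1"
    and "\<sigma> = poly p" and "degree p \<le> h"
    and "W 1 \<in> carrier_mat w0 n"
    and "\<And>l. 2 \<le> l \<Longrightarrow> l \<le> d0 \<Longrightarrow> W l \<in> carrier_mat w0 w0"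
    and "\<And>l. 1 \<le> l \<Longrightarrow> l \<le> d0 \<Longrightarrow> b l \<in> carrier_vec w0"
    and "wR \<in> carrier_vec w0" and "wI \<in> carrier_vec w0"
    and "\<Psi> = mlp_amplitude \<sigma> d0 W b wR bR wI bI"
    and "\<exists>s\<in>spin_configs n. \<Psi> s \<noteq> 0"
    and "A \<subseteq> {..<n}"
  shows "entanglement_entropy n A (normalize_state n \<Psi>) \<le>
    real w0 * ln ((real h ^ d0 + 1) * (real h ^ d0 + 2) / 2)"
proof -
  define u where "u = (\<lambda>j i. \<Sum>x\<in>A. W 1 $$ (j, x) * local_spin A i x)"
  note hidden = bipartite_poly_mlp_hidden[of A n p h W w0 d0 b d0, folded u_def, OF assms(13,5-8,2) order_refl]
  \<comment> \<open>The two readouts are the instances \<open>wR\<close>, \<open>bR\<close> and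
    \<open>wI\<close>, \<open>bI\<close>.\<close>
  have "bipartite_poly w0 u (h ^ d0) (\<lambda>i k. v \<bullet> mlp_hidden \<sigma> W b (joint_config n A i k) d0 + c)"
    if "v \<in> carrier_vec w0" for v c
    using hidden that unfolding assms(4) by (intro bipartite_poly_affine[where m = w0]) auto
  then have "entanglement_entropy n A (normalize_state n \<Psi>) \<le> real w0 * ln (real (h ^ d0) + 1)"
    using assms(9,10)
    by (intro entanglement_entropy_le_of_bipartite_poly[OF assms(13,12), where u = u])
       (simp_all add: assms(11) mlp_amplitude_def)
  also have "\<dots> \<le> real w0 * ln ((real h ^ d0 + 1) * (real h ^ d0 + 2) / 2)"
  proof -
    define q where "q = real h ^ d0"
    have "1 \<le> q" using assms(3) unfolding q_def by simp
    then have "(q + 1) * 1 \<le> (q + 1) * ((q + 2) / 2)" by (intro mult_left_mono) auto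
    then have "ln (q + 1) \<le> ln ((q + 1) * (q + 2) / 2)" using \<open>1 \<le> q\<close> by simp
    then show ?thesis by (intro mult_left_mono) (auto simp: q_def)
  qed
  finally show ?thesis .
qed

end
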